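(* Suppose that $a>0$ and $b>-2$ are real, and for $x>0$ let $$\mathcal{K}_{a,b}(x) = \sum_{i=1}^\infty i^{b+1}\prod_{j=1}^i\frac{x}{x+j^a}.$$ Then as $x\to\infty$, $\mathcal{K}_{a,b}(x)$ admits an asymptotic expansion such that $$\mathcal{K}_{a,b}(x) = \frac{\Gamma\left( \frac{b+2}{a+1} \right)}{(a+1)^{1-(b+2)/(a+1)}}\, x^{\frac{b+2}{a+1}} + O \left( x^{\frac{b+1}{a+1}}\right)\qquad\text{if } b>-1,$$ and $$\mathcal{K}_{a,b}(x) = \frac{\Gamma\left( \frac{b+2}{a+1} \right)}{(a+1)^{1-(b+2)/(a+1)}}\, x^{\frac{b+2}{a+1}} + O (1)\qquad\text{if } b\le -1.$$
   Context: $\Gamma$ is the Euler Gamma function. The implied constants in $O(\cdot)$ may depend on $a$ and $b$, and the $O$-estimates are as $x\to\infty$. *)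

theory Defs
  imports "HOL-Analysis.Gamma_Function" "HOL-Library.Landau_Symbols"
begin

definition K_term :: "real \<Rightarrow> real \<Rightarrow> real \<Rightarrow> nat \<Rightarrow> real" where
  "K_term a b x i = real i powr (b + 1) * (\<Prod>j = 1..i. x / (x + real j powr a))"

(* The sum over i = 1, 2, ... is written with a shifted index. *)
definition K :: "real \<Rightarrow> real \<Rightarrow> real \<Rightarrow> real" where
  "K a b x = (\<Sum>i. K_term a b x (Suc i))"

end

theory Submission
  imports Defs "HOL-Analysis.Analysis" "HOL-Real_Asymp.Real_Asymp"
begin

text \<open>Write \<open>c = a + 1\<close>, let \<open>P\<^sub>i\<close> be the product of the factors \<open>x / (x + j powr a)\<close> with
  \<open>j \<le> i\<close>, and let \<open>E\<^sub>i = exp (- (i powr c / (c * x)))\<close>. Since \<open>- ln P\<^sub>i\<close> is the sum of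
  \<open>ln (1 + j powr a / x)\<close>, replacing \<open>ln (1 + y)\<close> by \<open>y\<close> and the power sum by
  \<open>i powr c / c\<close> suggests that \<open>P\<^sub>i\<close> is close to \<open>E\<^sub>i\<close>. The sum of \<open>i powr (b + 1) * E\<^sub>i\<close> is in turn
  close to the integral of \<open>t powr (b + 1) * exp (- (t powr c / (c * x)))\<close> over the half line, which
  the substitution \<open>u = t powr c / (c * x)\<close> turns into the Gamma integral of the main term
  (\<open>has_integral_stretched_exp_moment\<close>).

  Passing from sums \<open>\<Sum> i powr \<gamma> * E\<^sub>i\<close> to integrals costs the total variation of the summand, which is
  \<open>O(x powr (\<gamma> / c))\<close> if \<open>\<gamma> > 0\<close>; if \<open>-1 < \<gamma> \<le> 0\<close> the summand decreases and the cost is \<open>O(1)\<close>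
  (\<open>moment_sum_asymptotics\<close>). For \<open>\<gamma> = b + 1\<close> these are exactly the two error terms of the theorem.

  The error of replacing \<open>P\<^sub>i\<close> by \<open>E\<^sub>i\<close> is no larger. The inequalities \<open>y - y\<^sup>2 \<le> ln (1 + y) \<le> y\<close>
  show that it is at most \<open>E\<^sub>i\<close> times \<open>i powr a / x + 2 * i powr (2 * a + 1) / x\<^sup>2\<close>
  as long as \<open>i powr (2 * a + 1) \<le> x\<^sup>2\<close>. Beyond that range \<open>P\<^sub>i \<le> exp (- (sqrt i / (2 * c)))\<close>, a bound that
  does not involve \<open>x\<close>, so that these terms contribute \<open>O(1)\<close> altogether (\<open>K_term_approx\<close>).
  The terms of typical size have \<open>i\<close> of order \<open>x powr (1 / c)\<close>, where both correction factors have order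
  \<open>x powr (- 1 / c)\<close>; summed, they contribute \<open>O(x powr ((b + 1) / c))\<close>, again by the moment
  estimates.\<close>

section \<open>Sums and integrals over unit intervals\<close>

lemma sums_unit_integrals:
  fixes f :: "real \<Rightarrow> real"
  assumes int: "f integrable_on {0..}" and nonneg: "\<And>t. t \<ge> 0 \<Longrightarrow> f t \<ge> 0"
  shows "(\<lambda>n. integral {real n..real n + 1} f) sums integral {0..} f"
proof -
  have int_on: "f integrable_on {s..t}" if "0 \<le> s" for s t
    using int by (rule integrable_on_subinterval) (use that in auto)
  have partial: "(\<Sum>n<N. integral {real n..real n + 1} f) = integral {0..real N} f" for N
  proof (induction N)
    case (Suc N)
    have "integral {0..real N} f + integral {real N..real N + 1} f = integral {0..real N + 1} f"
      by (rule Henstock_Kurzweil_Integration.integral_combine) (use int_on in auto)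
    with Suc show ?case by (simp add: add.commute)
  qed simp
  have restrict: "(\<lambda>t. if t \<in> {0..real N} then f t else 0) integrable_on {0..}"
       "integral {0..} (\<lambda>t. if t \<in> {0..real N} then f t else 0) = integral {0..real N} f" for N
    by (subst integrable_restrict_Int integral_restrict_Int, 
        use int_on in \<open>simp add: Int_absorb1 Icc_subset_Ici_iff\<close>)+
  have "(\<lambda>N. integral {0..} (\<lambda>t. if t \<in> {0..real N} then f t else 0)) \<longlonglongrightarrow> integral {0..} f"
  proof (rule dominated_convergence(2)[OF restrict(1) int])
    fix t :: real assume t: "t \<in> {0..}"
    have "eventually (\<lambda>N. t \<le> real N) sequentially"
      by (intro eventually_sequentiallyI[of "nat \<lceil>t\<rceil>"]) linarith
    then show "(\<lambda>N. if t \<in> {0..real N} then f t else 0) \<longlonglongrightarrow> f t"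
      by (intro tendsto_eventually, eventually_elim) (use t in auto)
  qed (use nonneg in auto)
  then show ?thesis unfolding sums_def partial restrict(2) .
qed

text \<open>The local form of the comparison of a series with an integral: the discrepancies on the unit
  intervals add up. The bound \<open>G\<close> is left abstract because it comes from the variation of \<open>f\<close> in one
  application and from a telescoping sum in the other.\<close>

lemma suminf_integral_diff_le:
  fixes f :: "real \<Rightarrow> real"
  assumes int: "f integrable_on {0..}" and nonneg: "\<And>t. t \<ge> 0 \<Longrightarrow> f t \<ge> 0"
    and bound: "\<And>n. \<bar>f (real n + 1) - integral {real n..real n + 1} f\<bar> \<le> G n"
    and G: "summable G"
  shows "summable (\<lambda>n. f (real n + 1))"
    and "\<bar>(\<Sum>n. f (real n + 1)) - integral {0..} f\<bar> \<le> suminf G"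
proof -
  let ?d = "\<lambda>n. f (real n + 1) - integral {real n..real n + 1} f"
  note I = sums_unit_integrals[OF int nonneg]
  have abs_d: "summable (\<lambda>n. \<bar>?d n\<bar>)"
    by (rule summable_comparison_test'[OF G]) (use bound in auto)
  then have d: "summable ?d" by (rule summable_rabs_cancel)
  from summable_add[OF d sums_summable[OF I]] show s: "summable (\<lambda>n. f (real n + 1))" by simp
  have "(\<Sum>n. f (real n + 1)) - integral {0..} f = suminf ?d"
    using suminf_diff[OF s sums_summable[OF I]] sums_unique[OF I] by simp
  also have "\<bar>\<dots>\<bar> \<le> (\<Sum>n. \<bar>?d n\<bar>)" by (rule summable_rabs[OF abs_d])
  also have "\<dots> \<le> suminf G" by (rule suminf_le[OF bound abs_d G])
  finally show "\<bar>(\<Sum>n. f (real n + 1)) - integral {0..} f\<bar> \<le> suminf G" .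
qed

section \<open>Moments of the stretched exponential\<close>

definition stretched_exp :: "real \<Rightarrow> real \<Rightarrow> real \<Rightarrow> real" where
  "stretched_exp c x t = exp (- (t powr c / (c * x)))"

text \<open>For \<open>c > 0\<close> and \<open>\<gamma> > -1\<close> this is the integral of \<open>t powr \<gamma> * stretched_exp c 1 t\<close> over \<open>t \<ge> 0\<close>.\<close>

definition moment_const :: "real \<Rightarrow> real \<Rightarrow> real" where
  "moment_const c \<gamma> = c powr ((\<gamma> + 1) / c - 1) * Gamma ((\<gamma> + 1) / c)"

text \<open>The substitution \<open>u = t powr c / (c * x)\<close> reduces the integral to Euler's integral for
  \<open>Gamma ((\<gamma> + 1) / c)\<close>.\<close>

lemma has_integral_stretched_exp_moment:
  assumes c: "c > 0" and x: "x > 0" and \<gamma>: "\<gamma> > -1"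
  shows "((\<lambda>t. t powr \<gamma> * stretched_exp c x t) has_integral
           moment_const c \<gamma> * x powr ((\<gamma> + 1) / c)) {0..}"
proof -
  define s where "s = (\<gamma> + 1) / c"
  have s: "s > 0" and cs: "c * s = \<gamma> + 1" using c \<gamma> by (auto simp: s_def)
  define g where "g t = t powr c / (c * x)" for t
  define g' where "g' t = t powr (c - 1) / x" for t
  define f where "f u = u powr (s - 1) / exp u" for u :: real
  have open_closed: "(h has_integral I) {0<..} \<longleftrightarrow> (h has_integral I) {0..}" for h :: "real \<Rightarrow> real" and I
  proof (rule has_integral_spike_set_eq)
    have "{t \<in> {0<..} - {0..}. h t \<noteq> 0} = {}" by auto
    then show "negligible {t \<in> {0<..} - {0..}. h t \<noteq> 0}" by (simp only: negligible_empty)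
    have "{t \<in> {0..} - {0<..}. h t \<noteq> 0} \<subseteq> {0}" by auto
    then show "negligible {t \<in> {0..} - {0<..}. h t \<noteq> 0}" by (meson negligible_sing negligible_subset)
  qed
  have f: "(f has_integral Gamma s) {0<..}"
    unfolding open_closed f_def by (rule Gamma_integral_real[OF s])
  then have f_abs: "f absolutely_integrable_on {0<..}" 
    by (intro nonnegative_absolutely_integrable_1) (auto simp: f_def has_integral_integrable)
  have img: "g ` {0<..} = {0<..}"
  proof (intro equalityI subsetI)
    fix u :: real assume u: "u \<in> {0<..}"
    then have "u = g ((c * x * u) powr (1 / c))"
      using c x by (simp add: g_def powr_powr)
    moreover have "(c * x * u) powr (1 / c) \<in> {0<..}" using u c x by auto
    ultimately show "u \<in> g ` {0<..}" by blast
  qed (use c x in \<open>auto simp: g_def\<close>)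
  have der: "(g has_field_derivative g' t) (at t within {0<..})" if "t \<in> {0<..}" for t
  proof -
    have "(g has_field_derivative (c * t powr (c - 1)) / (c * x)) (at t)"
      unfolding g_def by (rule DERIV_cdivide has_real_derivative_powr)+ (use that in auto)
    then show ?thesis using c by (auto simp: g'_def intro: has_field_derivative_at_within)
  qed
  have inj: "inj_on g {0<..}"
  proof (rule inj_onI)
    fix t u assume *: "t \<in> {0<..}" "u \<in> {0<..}" "g t = g u"
    then have "t powr c = u powr c" using c x by (simp add: g_def)
    then show "t = u" using * c by (metis greaterThan_iff less_irrefl powr_less_mono2 linorder_neqE_linordered_idom less_eq_real_def)
  qed
  have "(\<lambda>t. \<bar>g' t\<bar> * f (g t)) absolutely_integrable_on {0<..} \<and>
        integral {0<..} (\<lambda>t. \<bar>g' t\<bar> * f (g t)) = Gamma s"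
    by (subst has_absolute_integral_change_of_variables_1'[OF _ der inj])
       (use f f_abs in \<open>auto simp: img integral_unique\<close>)
  then have "((\<lambda>t. \<bar>g' t\<bar> * f (g t)) has_integral Gamma s) {0<..}"
    by (metis has_integral_integral set_lebesgue_integral_eq_integral(1))
  then have scaled: "((\<lambda>t. (c powr (s - 1) * x powr s) * (\<bar>g' t\<bar> * f (g t))) has_integral
               (c powr (s - 1) * x powr s) * Gamma s) {0<..}"
    by (rule has_integral_mult_right)
  \<comment> \<open>The transformed integrand is the wanted one up to the constant factor \<open>c powr (s - 1) * x powr s\<close>.\<close>
  have "(c powr (s - 1) * x powr s) * (\<bar>g' t\<bar> * f (g t)) = t powr \<gamma> * stretched_exp c x t"
    if t: "t \<in> {0<..}" for t
  proof -
    have "t powr (c - 1) * (t powr c) powr (s - 1) = t powr \<gamma>"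
      using t cs by (simp add: powr_powr powr_add[symmetric] algebra_simps)
    moreover have "x powr s = x * x powr (s - 1)"
      using x by (simp add: powr_mult_base)
    ultimately show ?thesis
      using t c x by (simp add: f_def g_def g'_def stretched_exp_def powr_divide powr_mult exp_minus field_simps)
  qed
  from has_integral_eq[OF this scaled] have "((\<lambda>t. t powr \<gamma> * stretched_exp c x t) has_integral
               (c powr (s - 1) * x powr s) * Gamma s) {0<..}" .
  then show ?thesis
    by (simp add: open_closed moment_const_def s_def mult_ac)
qed

lemma stretched_exp_pos: "stretched_exp c x t > 0"
  and stretched_exp_le_1: "c > 0 \<Longrightarrow> x > 0 \<Longrightarrow> stretched_exp c x t \<le> 1"
  by (auto simp: stretched_exp_def)

lemma stretched_exp_antimono:
  "c > 0 \<Longrightarrow> x > 0 \<Longrightarrow> 0 \<le> s \<Longrightarrow> s \<le> t \<Longrightarrow> stretched_exp c x t \<le> stretched_exp c x s"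
  by (auto simp: stretched_exp_def intro!: divide_right_mono powr_mono2)

lemma has_real_derivative_stretched_exp:
  assumes "c > 0" "x > 0" "t > 0"
  shows "(stretched_exp c x has_real_derivative - (t powr (c - 1) / x) * stretched_exp c x t) (at t)"
proof -
  have "((\<lambda>t. exp (- (t powr c / (c * x)))) has_real_derivative
          exp (- (t powr c / (c * x))) * - (c * t powr (c - 1) / (c * x))) (at t)"
    by (intro DERIV_fun_exp DERIV_minus DERIV_cdivide has_real_derivative_powr assms)
  then show ?thesis using assms unfolding stretched_exp_def[abs_def] by (simp add: mult_ac)
qed

lemma stretched_exp_moment_nonneg: "0 \<le> t powr \<gamma> * stretched_exp c x t"
  by (simp add: stretched_exp_pos less_imp_le)

text \<open>On a unit interval the summand deviates from its right end value by at most its variation there.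
  The derivative of \<open>t powr \<gamma> * stretched_exp c x t\<close> is a difference of two terms of the same shape,
  with exponents \<open>\<gamma> - 1\<close> and \<open>\<gamma> + c - 1\<close>, so the total variation is bounded by two moments, both
  of order \<open>x powr (\<gamma> / c)\<close>. The exponent must be positive for \<open>t powr (\<gamma> - 1)\<close> to be integrable
  at \<open>0\<close>.\<close>

lemma moment_sum_pos_exponent:
  assumes c: "c > 0" and \<gamma>: "\<gamma> > 0"
  obtains C where "\<And>x. x > 0 \<Longrightarrow> summable (\<lambda>n. (real n + 1) powr \<gamma> * stretched_exp c x (real n + 1))"
    and "\<And>x. x > 0 \<Longrightarrow> \<bar>(\<Sum>n. (real n + 1) powr \<gamma> * stretched_exp c x (real n + 1))
           - moment_const c \<gamma> * x powr ((\<gamma> + 1) / c)\<bar> \<le> C * x powr (\<gamma> / c)"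
proof
  let ?C = "\<gamma> * moment_const c (\<gamma> - 1) + moment_const c (\<gamma> + c - 1)"
  fix x :: real assume x: "x > 0"
  define f where "f t = t powr \<gamma> * stretched_exp c x t" for t
  \<comment> \<open>The derivative \<open>f'\<close> of \<open>f\<close> is a difference of two nonnegative terms; \<open>g\<close> is their sum.\<close>
  define g where "g t = \<gamma> * (t powr (\<gamma> - 1) * stretched_exp c x t)
                        + (t powr (\<gamma> + c - 1) * stretched_exp c x t) / x" for t
  define f' where "f' t = \<gamma> * (t powr (\<gamma> - 1) * stretched_exp c x t)
                        - (t powr (\<gamma> + c - 1) * stretched_exp c x t) / x" for t
  have f_int: "(f has_integral moment_const c \<gamma> * x powr ((\<gamma> + 1) / c)) {0..}"
    unfolding f_def by (rule has_integral_stretched_exp_moment) (use c x \<gamma> in auto)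
  have "(g has_integral (\<gamma> * (moment_const c (\<gamma> - 1) * x powr ((\<gamma> - 1 + 1) / c))
          + (moment_const c (\<gamma> + c - 1) * x powr ((\<gamma> + c - 1 + 1) / c)) / x)) {0..}"
    unfolding g_def
    by (intro has_integral_add has_integral_mult_right has_integral_divide has_integral_stretched_exp_moment)
       (use c x \<gamma> in auto)
  moreover have "x powr ((\<gamma> + c - 1 + 1) / c) = x * x powr (\<gamma> / c)"
    using c x by (simp add: add_divide_distrib powr_add)
  ultimately have g_int: "(g has_integral (?C * x powr (\<gamma> / c))) {0..}"
    using x by (simp add: distrib_right mult.assoc)
  have g_nonneg: "g t \<ge> 0" for t
    using \<gamma> x unfolding g_def by (intro add_nonneg_nonneg mult_nonneg_nonneg divide_nonneg_nonneg
         less_imp_le[OF stretched_exp_pos]) auto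
  have g_on: "g integrable_on {s..t}" if "0 \<le> s" for s t
    using has_integral_integrable[OF g_int] by (rule integrable_on_subinterval) (use that in auto)
  have f_on: "f integrable_on {s..t}" if "0 \<le> s" for s t
    using has_integral_integrable[OF f_int] by (rule integrable_on_subinterval) (use that in auto)
  have der: "(f has_real_derivative f' t) (at t)" if "t > 0" for t
  proof -
    have "(f has_real_derivative (\<gamma> * t powr (\<gamma> - 1)) * stretched_exp c x t
             + (- (t powr (c - 1) / x) * stretched_exp c x t) * t powr \<gamma>) (at t)"
      unfolding f_def[abs_def]
      by (intro DERIV_mult has_real_derivative_powr has_real_derivative_stretched_exp c x that)
    moreover have "t powr (\<gamma> + c - 1) = t powr \<gamma> * t powr (c - 1)"
      by (simp add: powr_add[symmetric] algebra_simps)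
    ultimately show ?thesis by (simp add: f'_def mult_ac)
  qed
  have cont: "continuous_on {s..t} f" if "0 \<le> s" for s t
    unfolding f_def[abs_def] stretched_exp_def[abs_def]
    by (intro continuous_intros continuous_on_powr') (use that c x \<gamma> in auto)
  have osc: "\<bar>f v - f u\<bar> \<le> integral {u..v} g" if uv: "0 \<le> u" "u \<le> v" for u v
  proof -
    have "(f' has_integral f v - f u) {u..v}"
      using uv by (intro fundamental_theorem_of_calculus_interior cont)
        (auto simp: has_real_derivative_iff_has_vector_derivative[symmetric] intro!: der)
    then have *: "f' integrable_on {u..v}" "f v - f u = integral {u..v} f'" by (auto simp: integral_unique)
    have "norm (f' t) \<le> g t" for t
      unfolding f'_def g_def real_norm_def
      by (rule order_trans[OF abs_triangle_ineq4])
         (use \<gamma> x in \<open>simp add: abs_mult abs_of_pos[OF stretched_exp_pos]\<close>)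
    then show ?thesis
      unfolding *(2) by (metis "*"(1) g_on integral_norm_bound_integral real_norm_def uv(1))
  qed
  have bound: "\<bar>f (real n + 1) - integral {real n..real n + 1} f\<bar> \<le> integral {real n..real n + 1} g" for n
  proof -
    have "f (real n + 1) - integral {real n..real n + 1} f = integral {real n..real n + 1} (\<lambda>t. f (real n + 1) - f t)"
      using f_on by (simp add: Henstock_Kurzweil_Integration.integral_diff integrable_on_const)
    also have "norm \<dots> \<le> integral {real n..real n + 1} (\<lambda>t. integral {real n..real n + 1} g)"
    proof (rule integral_norm_bound_integral)
      fix t assume t: "t \<in> {real n..real n + 1}"
      have "\<bar>f (real n + 1) - f t\<bar> \<le> integral {t..real n + 1} g" by (rule osc) (use t in auto)
      also have "\<dots> \<le> integral {real n..real n + 1} g"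
        by (rule integral_subset_le) (use t g_on g_nonneg in auto)
      finally show "norm (f (real n + 1) - f t) \<le> integral {real n..real n + 1} g" by simp
    qed (use f_on in \<open>auto intro!: integrable_diff simp: integrable_on_const\<close>)
    also have "\<dots> = integral {real n..real n + 1} g" by simp
    finally show ?thesis by simp
  qed
  note G = sums_unit_integrals[OF has_integral_integrable[OF g_int] g_nonneg]
  have f_nonneg: "f t \<ge> 0" for t unfolding f_def by (rule stretched_exp_moment_nonneg)
  note res = suminf_integral_diff_le[OF has_integral_integrable[OF f_int] f_nonneg bound sums_summable[OF G]]
  show "summable (\<lambda>n. (real n + 1) powr \<gamma> * stretched_exp c x (real n + 1))"
    using res(1) by (simp add: f_def)
  show "\<bar>(\<Sum>n. (real n + 1) powr \<gamma> * stretched_exp c x (real n + 1))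
           - moment_const c \<gamma> * x powr ((\<gamma> + 1) / c)\<bar> \<le> ?C * x powr (\<gamma> / c)"
    using res(2) unfolding sums_unique[OF G, symmetric] integral_unique[OF f_int] integral_unique[OF g_int]
    by (simp only: f_def)
qed

text \<open>Here the summand \<open>f\<close> decreases on \<open>t > 0\<close>, so the error on \<open>{n..n + 1}\<close> is at most \<open>f n - f (n + 1)\<close>
  for \<open>n \<ge> 1\<close>, and these differences telescope. The first interval is treated separately because \<open>f\<close>
  may be unbounded near \<open>0\<close>; its integral over \<open>{0..1}\<close> is at most \<open>1 / (\<gamma> + 1)\<close>.\<close>

lemma moment_sum_nonpos_exponent:
  assumes c: "c > 0" and \<gamma>: "-1 < \<gamma>" "\<gamma> \<le> 0" and x: "x > 0"
  shows "summable (\<lambda>n. (real n + 1) powr \<gamma> * stretched_exp c x (real n + 1))"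
    and "\<bar>(\<Sum>n. (real n + 1) powr \<gamma> * stretched_exp c x (real n + 1))
           - moment_const c \<gamma> * x powr ((\<gamma> + 1) / c)\<bar> \<le> 2 + 1 / (\<gamma> + 1)"
proof -
  define f where "f t = t powr \<gamma> * stretched_exp c x t" for t
  \<comment> \<open>At \<open>n = 0\<close> both \<open>f 1 \<le> 1\<close> and the integral over \<open>{0..1}\<close> are nonnegative, so the sum of their bounds will do.\<close>
  define G where "G n = (if n = 0 then 1 + 1 / (\<gamma> + 1) else f (real n) - f (real n + 1))" for n
  have f_int: "(f has_integral moment_const c \<gamma> * x powr ((\<gamma> + 1) / c)) {0..}"
    unfolding f_def by (rule has_integral_stretched_exp_moment) (use c x \<gamma> in auto)
  have f_on: "f integrable_on {s..t}" if "0 \<le> s" for s t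
    using has_integral_integrable[OF f_int] by (rule integrable_on_subinterval) (use that in auto)
  have f_nonneg: "f t \<ge> 0" for t unfolding f_def by (rule stretched_exp_moment_nonneg)
  have antimono: "f t \<le> f s" if "0 < s" "s \<le> t" for s t
    unfolding f_def using that c x \<gamma>
    by (intro mult_mono powr_mono2' stretched_exp_antimono less_imp_le[OF stretched_exp_pos]) auto
  have f_1: "f 1 \<le> 1" using c x by (simp add: f_def stretched_exp_le_1)
  have bound: "\<bar>f (real n + 1) - integral {real n..real n + 1} f\<bar> \<le> G n" for n
  proof (cases "n = 0")
    case True
    have pow: "((\<lambda>t. t powr \<gamma>) has_integral 1 / (\<gamma> + 1)) {0..1}"
      using has_integral_powr_from_0[of \<gamma> 1] \<gamma> by simp
    have "integral {0..1} f \<le> 1 / (\<gamma> + 1)"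
      by (rule has_integral_le[OF integrable_integral[OF f_on] pow])
         (use c x in \<open>auto simp: f_def intro!: mult_left_le stretched_exp_le_1\<close>)
    moreover have "integral {0..1} f \<ge> 0"
      using f_nonneg f_on by (intro integral_nonneg) auto
    ultimately show ?thesis using True f_1 f_nonneg[of 1] by (simp add: G_def)
  next
    case False
    have "integral {real n..real n + 1} f \<le> integral {real n..real n + 1} (\<lambda>t. f (real n))"
      by (rule integral_le) (use False f_on in \<open>auto intro!: antimono simp: integrable_on_const\<close>)
    moreover have "integral {real n..real n + 1} (\<lambda>t. f (real n + 1)) \<le> integral {real n..real n + 1} f"
      by (rule integral_le) (use False f_on in \<open>auto intro!: antimono simp: integrable_on_const\<close>)
    ultimately show ?thesis using False by (simp add: G_def)
  qed
  have G_partial: "(\<Sum>n<Suc N. G n) = 1 + 1 / (\<gamma> + 1) + f 1 - f (real N + 1)" for N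
    by (induction N) (simp_all add: G_def add_ac)
  have G_le: "(\<Sum>n<N. G n) \<le> 2 + 1 / (\<gamma> + 1)" for N
  proof (cases N)
    case (Suc M)
    then show ?thesis using G_partial[of M] f_1 f_nonneg[of "real M + 1"] by simp
  qed (use \<gamma> in auto)
  have "G n \<ge> 0" for n using bound[of n] by linarith
  then have G: "summable G" by (rule summableI_nonneg_bounded[OF _ G_le])
  note res = suminf_integral_diff_le[OF has_integral_integrable[OF f_int] f_nonneg bound G]
  show "summable (\<lambda>n. (real n + 1) powr \<gamma> * stretched_exp c x (real n + 1))"
    using res(1) by (simp add: f_def)
  show "\<bar>(\<Sum>n. (real n + 1) powr \<gamma> * stretched_exp c x (real n + 1))
           - moment_const c \<gamma> * x powr ((\<gamma> + 1) / c)\<bar> \<le> 2 + 1 / (\<gamma> + 1)"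
    using order_trans[OF res(2) suminf_le_const[OF G G_le]]
    unfolding integral_unique[OF f_int] by (simp only: f_def)
qed

lemma moment_sum_asymptotics:
  assumes c: "c > 0" and \<gamma>: "\<gamma> > -1"
  obtains C where "C \<ge> 0" "\<And>x. x \<ge> 1 \<Longrightarrow> summable (\<lambda>n. (real n + 1) powr \<gamma> * stretched_exp c x (real n + 1))"
    and "\<And>x. x \<ge> 1 \<Longrightarrow> \<bar>(\<Sum>n. (real n + 1) powr \<gamma> * stretched_exp c x (real n + 1))
           - moment_const c \<gamma> * x powr ((\<gamma> + 1) / c)\<bar> \<le> C * x powr (max 0 \<gamma> / c)"
proof (cases "\<gamma> > 0")
  case True
  obtain C where C: "\<And>x. x > 0 \<Longrightarrow> summable (\<lambda>n. (real n + 1) powr \<gamma> * stretched_exp c x (real n + 1))"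
       "\<And>x. x > 0 \<Longrightarrow> \<bar>(\<Sum>n. (real n + 1) powr \<gamma> * stretched_exp c x (real n + 1))
           - moment_const c \<gamma> * x powr ((\<gamma> + 1) / c)\<bar> \<le> C * x powr (\<gamma> / c)"
    by (rule moment_sum_pos_exponent[OF c True]) blast
  have "0 \<le> C" using order_trans[OF abs_ge_zero C(2)[of 1]] by simp
  then show ?thesis by (rule that[of C]) (use C True in auto)
next
  case False
  then show ?thesis using moment_sum_nonpos_exponent[OF c \<gamma>] \<gamma>
    by (intro that[of "2 + 1 / (\<gamma> + 1)"]) auto
qed

text \<open>The order of magnitude of the moment sums, which is what the correction terms need: for \<open>\<gamma> > -1\<close> the
  error in \<open>moment_sum_asymptotics\<close> never exceeds the order of the main term.\<close>

lemma moment_sum_bound: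
  assumes c: "c > 0" and \<gamma>: "\<gamma> > -1"
  obtains B where "\<And>x. x \<ge> 1 \<Longrightarrow>
    (\<Sum>n. (real n + 1) powr \<gamma> * stretched_exp c x (real n + 1)) \<le> B * x powr ((\<gamma> + 1) / c)"
proof -
  obtain C where C: "C \<ge> 0" "\<And>x. x \<ge> 1 \<Longrightarrow> \<bar>(\<Sum>n. (real n + 1) powr \<gamma> * stretched_exp c x (real n + 1))
           - moment_const c \<gamma> * x powr ((\<gamma> + 1) / c)\<bar> \<le> C * x powr (max 0 \<gamma> / c)"
    by (rule moment_sum_asymptotics[OF c \<gamma>]) blast
  show ?thesis
  proof (rule that[of "moment_const c \<gamma> + C"])
    fix x :: real assume x: "x \<ge> 1"
    have "C * x powr (max 0 \<gamma> / c) \<le> C * x powr ((\<gamma> + 1) / c)"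
      using C(1) x c \<gamma> by (intro mult_left_mono powr_mono divide_right_mono) auto
    with C(2)[OF x] show "(\<Sum>n. (real n + 1) powr \<gamma> * stretched_exp c x (real n + 1))
         \<le> (moment_const c \<gamma> + C) * x powr ((\<gamma> + 1) / c)"
      by (simp add: algebra_simps)
  qed
qed

section \<open>The product compared with the stretched exponential\<close>

lemma sum_powr_bounds:
  assumes a: "a > (0::real)"
  shows "real i powr (a + 1) / (a + 1) \<le> (\<Sum>j = 1..i. real j powr a)"
    and "(\<Sum>j = 1..i. real j powr a) \<le> real i powr (a + 1) / (a + 1) + real i powr a"
proof -
  \<comment> \<open>By the mean value theorem the increment of \<open>t powr (a + 1) / (a + 1)\<close> over \<open>{i..i + 1}\<close> is \<open>z powr a\<close> for an intermediate \<open>z\<close>.\<close>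
  have step: "real i powr a \<le> (real (Suc i) powr (a + 1) - real i powr (a + 1)) / (a + 1)
     \<and> (real (Suc i) powr (a + 1) - real i powr (a + 1)) / (a + 1) \<le> real (Suc i) powr a" for i
  proof -
    have cont: "continuous_on {real i..real (Suc i)} (\<lambda>t. t powr (a + 1))"
      by (intro continuous_on_powr' continuous_intros) (use a in auto)
    have der: "((\<lambda>t. t powr (a + 1)) has_real_derivative (a + 1) * z powr a) (at z)" if "real i < z" for z
      using has_real_derivative_powr[of z "a + 1"] that by simp
    obtain l z where "real i < z" "z < real (Suc i)" "((\<lambda>t. t powr (a + 1)) has_real_derivative l) (at z)"
       "real (Suc i) powr (a + 1) - real i powr (a + 1) = (real (Suc i) - real i) * l"
      using MVT[OF _ cont] der real_differentiable_def by auto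
    then obtain z where z: "real i < z" "z < real (Suc i)" 
       "real (Suc i) powr (a + 1) - real i powr (a + 1) = (a + 1) * z powr a"
      using DERIV_unique[OF der] by fastforce
    then show ?thesis using a by (auto intro!: powr_mono2)
  qed
  show "real i powr (a + 1) / (a + 1) \<le> (\<Sum>j = 1..i. real j powr a)"
  proof (induction i)
    case (Suc i)
    then show ?case using step[of i] by (simp add: diff_divide_distrib)
  qed (use a in auto)
  show "(\<Sum>j = 1..i. real j powr a) \<le> real i powr (a + 1) / (a + 1) + real i powr a"
  proof (induction i)
    case (Suc i)
    then show ?case using step[of i] by (simp add: diff_divide_distrib)
  qed (use a in auto)
qed

lemma prod_eq_exp:
  assumes x: "x > (0::real)"
  shows "(\<Prod>j = 1..i. x / (x + real j powr a)) = exp (- (\<Sum>j = 1..i. ln (1 + real j powr a / x)))"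
proof -
  have "x / (x + real j powr a) = exp (- ln (1 + real j powr a / x))" for j
  proof -
    have "1 + real j powr a / x > 0" using x by (simp add: add_pos_nonneg)
    then have "exp (- ln (1 + real j powr a / x)) = inverse (1 + real j powr a / x)"
      by (simp add: exp_minus)
    then show ?thesis using x by (simp add: field_simps)
  qed
  then show ?thesis by (simp add: exp_sum sum_negf[symmetric] del: sum_negf)
qed

lemma prod_lower:
  assumes a: "a > 0" and x: "x > (0::real)"
  shows "stretched_exp (a + 1) x (real i) * (1 - real i powr a / x)
          \<le> (\<Prod>j = 1..i. x / (x + real j powr a))"
proof -
  have "(\<Sum>j = 1..i. ln (1 + real j powr a / x)) \<le> (\<Sum>j = 1..i. real j powr a / x)"
    by (intro sum_mono ln_add_one_self_le_self) (use x in auto)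
  also have "\<dots> = (\<Sum>j = 1..i. real j powr a) / x" by (simp add: sum_divide_distrib)
  also have "\<dots> \<le> (real i powr (a + 1) / (a + 1) + real i powr a) / x"
    using sum_powr_bounds(2)[OF a] x by (intro divide_right_mono) auto
  finally have "stretched_exp (a + 1) x (real i) * exp (- (real i powr a / x))
           \<le> exp (- (\<Sum>j = 1..i. ln (1 + real j powr a / x)))"
    by (simp add: stretched_exp_def exp_add[symmetric] add_divide_distrib)
  moreover have "1 - real i powr a / x \<le> exp (- (real i powr a / x))"
    using exp_ge_add_one_self[of "- (real i powr a / x)"] by simp
  ultimately show ?thesis unfolding prod_eq_exp[OF x]
    by (meson mult_left_mono order_trans stretched_exp_pos less_imp_le)
qed

text \<open>In the bulk range every \<open>y = j powr a / x\<close> is at most \<open>1\<close>, so \<open>ln (1 + y) \<ge> y - y\<^sup>2\<close> applies. The squares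
  add up to at most \<open>u = i powr (2 * a + 1) / x\<^sup>2 \<le> 1\<close>, and \<open>exp u \<le> 1 + 2 * u\<close> for such \<open>u\<close>.\<close>

lemma prod_upper_bulk:
  assumes a: "a > 0" and x: "x > (0::real)" and i: "real i powr (2 * a + 1) \<le> x\<^sup>2"
  shows "(\<Prod>j = 1..i. x / (x + real j powr a))
          \<le> stretched_exp (a + 1) x (real i) * (1 + 2 * (real i powr (2 * a + 1) / x\<^sup>2))"
proof -
  define u where "u = real i powr (2 * a + 1) / x\<^sup>2"
  have u: "0 \<le> u" "u \<le> 1" using i x by (auto simp: u_def)
  have sq: "(real j powr a / x)\<^sup>2 \<le> real i powr (2 * a) / x\<^sup>2" if "j \<in> {1..i}" for j
  proof -
    have "(real j powr a)\<^sup>2 = real j powr (2 * a)"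
      using that by (simp add: power2_eq_square powr_add[symmetric])
    also have "\<dots> \<le> real i powr (2 * a)" using that a by (intro powr_mono2) auto
    finally show ?thesis using x by (simp add: power_divide divide_right_mono)
  qed
  have le1: "real j powr a / x \<le> 1" if "j \<in> {1..i}" for j
  proof -
    have "real i powr (2 * a) \<le> real i powr (2 * a + 1)"
      using that by (intro powr_mono) auto
    with i have "real i powr (2 * a) / x\<^sup>2 \<le> 1" using x by simp
    with sq[OF that] have "(real j powr a / x)\<^sup>2 \<le> 1\<^sup>2" by simp
    then show ?thesis by (rule power2_le_imp_le) simp
  qed
  have "real i powr (a + 1) / (a + 1) / x - u
      \<le> (\<Sum>j = 1..i. real j powr a) / x - (\<Sum>j = 1..i. real i powr (2 * a) / x\<^sup>2)"
  proof (intro diff_mono divide_right_mono sum_powr_bounds a)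
    have "real i powr (2 * a + 1) = real i * real i powr (2 * a)"
      using powr_mult_base[of "real i" "2 * a"] by (simp add: add.commute)
    then have "(\<Sum>j = 1..i. real i powr (2 * a) / x\<^sup>2) = real i powr (2 * a + 1) / x\<^sup>2"
      by simp
    then show "(\<Sum>j = 1..i. real i powr (2 * a) / x\<^sup>2) \<le> u" unfolding u_def by (rule eq_refl)
  qed (use x in auto)
  also have "\<dots> = (\<Sum>j = 1..i. real j powr a / x - real i powr (2 * a) / x\<^sup>2)"
    by (simp add: sum_divide_distrib sum_subtractf)
  also have "\<dots> \<le> (\<Sum>j = 1..i. ln (1 + real j powr a / x))"
  proof (rule sum_mono)
    fix j assume j: "j \<in> {1..i}"
    have "real j powr a / x - (real j powr a / x)\<^sup>2 \<le> ln (1 + real j powr a / x)"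
      using x le1[OF j] by (intro ln_one_plus_pos_lower_bound) auto
    with sq[OF j] show "real j powr a / x - real i powr (2 * a) / x\<^sup>2 \<le> ln (1 + real j powr a / x)"
      by linarith
  qed
  finally have "exp (- (\<Sum>j = 1..i. ln (1 + real j powr a / x))) \<le> stretched_exp (a + 1) x (real i) * exp u"
    by (simp add: stretched_exp_def exp_add[symmetric])
  also have "exp u \<le> 1 + u + u\<^sup>2" by (rule exp_bound[OF u])
  also have "u\<^sup>2 \<le> u" using u by (simp add: power2_eq_square mult_left_le)
  finally show ?thesis
    unfolding prod_eq_exp[OF x] u_def[symmetric] by (simp add: stretched_exp_pos mult_left_mono add_ac)
qed

text \<open>The product increases with \<open>x\<close>, and in the tail range \<open>x \<le> z = i powr (a + 1 / 2)\<close>, so \<open>x\<close> may be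
  replaced by \<open>z\<close>. Then \<open>y = j powr a / z \<le> 1\<close> and \<open>ln (1 + y) \<ge> y / 2\<close>, and the sum of the \<open>y\<close> is at
  least \<open>i powr (a + 1) / ((a + 1) * z) = sqrt i / (a + 1)\<close>.\<close>

lemma prod_upper_tail:
  assumes a: "a > 0" and x: "x > (0::real)" and i: "x\<^sup>2 \<le> real i powr (2 * a + 1)"
  shows "(\<Prod>j = 1..i. x / (x + real j powr a)) \<le> exp (- (sqrt (real i) / (2 * (a + 1))))"
proof -
  have i0: "i > 0" using i x by (cases "i = 0") auto
  define z where "z = real i powr (a + 1 / 2)"
  have z: "z > 0" using i0 by (simp add: z_def)
  have "z\<^sup>2 = real i powr (2 * a + 1)"
    by (simp add: z_def power2_eq_square powr_add[symmetric])
  with i have "x\<^sup>2 \<le> z\<^sup>2" by simp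
  then have xz: "x \<le> z" by (rule power2_le_imp_le) (use z in simp)
  have "sqrt (real i) / (2 * (a + 1)) = (real i powr (a + 1) / (a + 1)) / (2 * z)"
  proof -
    have "real i powr (a + 1) = sqrt (real i) * z"
      using i0 by (simp add: z_def powr_half_sqrt[symmetric] powr_add[symmetric] add_ac)
    then show ?thesis using z a by simp
  qed
  also have "\<dots> \<le> (\<Sum>j = 1..i. real j powr a) / (2 * z)"
    using z a by (intro divide_right_mono sum_powr_bounds) auto
  also have "\<dots> = (\<Sum>j = 1..i. real j powr a / z / 2)" by (simp add: sum_divide_distrib mult.commute)
  also have "\<dots> \<le> (\<Sum>j = 1..i. ln (1 + real j powr a / x))"
  proof (rule sum_mono)
    fix j assume j: "j \<in> {1..i}"
    define y where "y = real j powr a / z"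
    have "real j powr a \<le> real i powr a" using j a by (intro powr_mono2) auto
    also have "\<dots> \<le> z" unfolding z_def using i0 by (intro powr_mono) auto
    finally have y: "0 \<le> y" "y \<le> 1" using z by (auto simp: y_def)
    have "y / 2 \<le> ln (1 + y)"
    proof -
      have "exp (y / 2) \<le> 1 + 2 * (y / 2)" by (rule real_exp_bound_lemma) (use y in auto)
      then show ?thesis using y by (subst ln_ge_iff) auto
    qed
    also have "\<dots> \<le> ln (1 + real j powr a / x)"
      using y x xz z by (auto simp: y_def intro!: ln_mono divide_left_mono add_pos_nonneg)
    finally show "real j powr a / z / 2 \<le> ln (1 + real j powr a / x)" by (simp add: y_def)
  qed
  finally show ?thesis unfolding prod_eq_exp[OF x] by simp
qed

lemma summable_powr_exp_sqrt:
  assumes "k > (0::real)"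
  shows "summable (\<lambda>n. (real n + 1) powr \<beta> * exp (- (sqrt (real n + 1) / k)))"
proof (rule summable_comparison_test_bigo)
  show "summable (\<lambda>n. norm (real (n+1) powr (-2)))"
    using summable_ignore_initial_segment[of "\<lambda>n. real n powr (-2)" 1]
    by (simp add: summable_real_powr_iff)
  show "(\<lambda>n. (real n + 1) powr \<beta> * exp (- (sqrt (real n + 1) / k))) \<in> O(\<lambda>n. real (n+1) powr (-2))"
    using assms by real_asymp
qed

section \<open>Asymptotics of the series\<close>

lemma K_term_Suc:
  "K_term a b x (Suc n) = (real n + 1) powr (b + 1) * (\<Prod>j = 1..Suc n. x / (x + real j powr a))"
  by (simp add: K_term_def add.commute)

lemma K_term_nonneg: "x > 0 \<Longrightarrow> K_term a b x i \<ge> 0"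
  by (auto simp: K_term_def intro!: mult_nonneg_nonneg prod_nonneg)

lemma summable_K_term:
  assumes a: "a > 0" and x: "x > (0::real)"
  shows "summable (\<lambda>n. K_term a b x (Suc n))"
proof (rule summable_comparison_test_ev)
  show "summable (\<lambda>n. (real n + 1) powr (b + 1) * exp (- (sqrt (real n + 1) / (2 * (a + 1)))))"
    by (rule summable_powr_exp_sqrt) (use a in simp)
  have "filterlim (\<lambda>n. real (Suc n) powr (2 * a + 1)) at_top sequentially"
    using a by real_asymp
  then have "\<forall>\<^sub>F n in sequentially. x\<^sup>2 \<le> real (Suc n) powr (2 * a + 1)"
    by (simp add: filterlim_at_top)
  then show "\<forall>\<^sub>F n in sequentially. norm (K_term a b x (Suc n))
      \<le> (real n + 1) powr (b + 1) * exp (- (sqrt (real n + 1) / (2 * (a + 1))))"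
  proof eventually_elim
    case (elim n)
    from prod_upper_tail[OF a x elim] show ?case
      using K_term_nonneg[OF x, of a b "Suc n"]
      by (simp add: K_term_Suc mult_left_mono add.commute del: prod.cl_ivl_Suc)
  qed
qed

text \<open>The bulk and tail estimates in one inequality valid for all \<open>n\<close>, in a form that can be summed: the first
  two terms are moments of the stretched exponential, and the last one is summable and independent
  of \<open>x\<close>.\<close>

lemma K_term_approx:
  fixes x :: real and n :: nat
  assumes a: "a > 0" and x: "x > 0"
  defines "t \<equiv> real n + 1"
  defines "E \<equiv> stretched_exp (a + 1) x t"
  shows "\<bar>K_term a b x (Suc n) - t powr (b + 1) * E\<bar>
      \<le> (t powr (a + b + 1) * E) / x + 2 * (t powr (2 * a + b + 2) * E) / x\<^sup>2
         + t powr (b + 1) * exp (- (sqrt t / (2 * (a + 1))))"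
proof -
  define P where "P = (\<Prod>j = 1..Suc n. x / (x + real j powr a))"
  have t: "t = real (Suc n)" "t > 0" by (auto simp: t_def)
  have E: "E \<ge> 0" unfolding E_def by (rule less_imp_le[OF stretched_exp_pos])
  have "P \<ge> E * (1 - t powr a / x)"
    using prod_lower[OF a x, of "Suc n"] unfolding P_def E_def t by simp
  moreover have "P \<le> E * (1 + 2 * (t powr (2 * a + 1) / x\<^sup>2)) + exp (- (sqrt t / (2 * (a + 1))))"
  proof (cases "t powr (2 * a + 1) \<le> x\<^sup>2")
    case True
    then have "P \<le> E * (1 + 2 * (t powr (2 * a + 1) / x\<^sup>2))"
      using prod_upper_bulk[OF a x, of "Suc n"] unfolding P_def E_def t by simp
    then show ?thesis by (smt (verit) exp_gt_zero)
  next
    case False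
    then have "P \<le> exp (- (sqrt t / (2 * (a + 1))))"
      using prod_upper_tail[OF a x, of "Suc n"] unfolding P_def t by simp
    moreover have "E * (1 + 2 * (t powr (2 * a + 1) / x\<^sup>2)) \<ge> 0"
      using E by (intro mult_nonneg_nonneg add_nonneg_nonneg) auto
    ultimately show ?thesis by linarith
  qed
  moreover have "E * (t powr a / x) \<ge> 0" "E * (2 * (t powr (2 * a + 1) / x\<^sup>2)) \<ge> 0"
    using E x by auto
  ultimately have "\<bar>P - E\<bar> \<le> E * (t powr a / x) + E * (2 * (t powr (2 * a + 1) / x\<^sup>2))
       + exp (- (sqrt t / (2 * (a + 1))))"
    unfolding abs_le_iff using exp_gt_zero[of "- (sqrt t / (2 * (a + 1)))"]
    unfolding right_diff_distrib distrib_left mult_1_right by linarith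
  then have "t powr (b + 1) * \<bar>P - E\<bar> \<le> t powr (b + 1) * (E * (t powr a / x)
       + E * (2 * (t powr (2 * a + 1) / x\<^sup>2)) + exp (- (sqrt t / (2 * (a + 1)))))"
    by (intro mult_left_mono) auto
  moreover have "K_term a b x (Suc n) - t powr (b + 1) * E = t powr (b + 1) * (P - E)"
    unfolding K_term_Suc P_def t_def by (simp only: right_diff_distrib)
  moreover have "t powr (a + b + 1) = t powr (b + 1) * t powr a"
       "t powr (2 * a + b + 2) = t powr (b + 1) * t powr (2 * a + 1)"
    by (simp_all add: powr_add[symmetric] add_ac)
  ultimately show ?thesis
    by (simp add: abs_mult distrib_left mult_ac)
qed

text \<open>Both cases of the theorem at once: the exponent \<open>max 0 (b + 1)\<close> is \<open>b + 1\<close> if \<open>b > -1\<close> and \<open>0\<close> otherwise.\<close>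

lemma K_asymptotics:
  assumes a: "a > 0" and b: "b > -2"
  shows "(\<lambda>x. K a b x - moment_const (a + 1) (b + 1) * x powr ((b + 2) / (a + 1)))
           \<in> O[at_top](\<lambda>x. x powr (max 0 (b + 1) / (a + 1)))"
proof -
  define S where "S \<gamma> x = (\<Sum>n. (real n + 1) powr \<gamma> * stretched_exp (a + 1) x (real n + 1))" for \<gamma> x
  define T where "T = (\<Sum>n. (real n + 1) powr (b + 1) * exp (- (sqrt (real n + 1) / (2 * (a + 1)))))"
  have c: "a + 1 > 0" using a by simp
  have T: "summable (\<lambda>n. (real n + 1) powr (b + 1) * exp (- (sqrt (real n + 1) / (2 * (a + 1)))))"
    by (rule summable_powr_exp_sqrt) (use a in simp)
  have S: "summable (\<lambda>n. (real n + 1) powr \<gamma> * stretched_exp (a + 1) x (real n + 1))"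
    if "\<gamma> > -1" "x \<ge> 1" for \<gamma> x
    by (rule moment_sum_asymptotics[OF c that(1)]) (use that in blast)
  obtain C where C: "C \<ge> 0" "\<And>x. x \<ge> 1 \<Longrightarrow> \<bar>S (b + 1) x
      - moment_const (a + 1) (b + 1) * x powr ((b + 1 + 1) / (a + 1))\<bar> \<le> C * x powr (max 0 (b + 1) / (a + 1))"
    unfolding S_def by (rule moment_sum_asymptotics[OF c, of "b + 1"]) (use b in \<open>simp, blast\<close>)
  obtain B1 where B1: "\<And>x. x \<ge> 1 \<Longrightarrow> S (a + b + 1) x \<le> B1 * x powr ((a + b + 1 + 1) / (a + 1))"
    unfolding S_def by (rule moment_sum_bound[OF c, of "a + b + 1"]) (use a b in \<open>simp, blast\<close>)
  obtain B2 where B2: "\<And>x. x \<ge> 1 \<Longrightarrow> S (2 * a + b + 2) x \<le> B2 * x powr ((2 * a + b + 2 + 1) / (a + 1))"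
    unfolding S_def by (rule moment_sum_bound[OF c, of "2 * a + b + 2"]) (use a b in \<open>simp, blast\<close>)
  have main: "\<bar>K a b x - moment_const (a + 1) (b + 1) * x powr ((b + 2) / (a + 1))\<bar>
      \<le> (C + \<bar>B1\<bar> + 2 * \<bar>B2\<bar> + \<bar>T\<bar>) * x powr (max 0 (b + 1) / (a + 1))" if x: "x \<ge> 1" for x
  proof -
    let ?r = "x powr (max 0 (b + 1) / (a + 1))"
    let ?E = "\<lambda>n. stretched_exp (a + 1) x (real n + 1)"
    have x0: "x > 0" using x by simp
    \<comment> \<open>The correction terms have order \<open>x powr ((b + 1) / (a + 1))\<close> and the tail has order \<open>1\<close>; the target dominates both.\<close>
    have r: "x powr ((b + 1) / (a + 1)) \<le> ?r" "1 \<le> ?r"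
      using x a by (auto intro!: powr_mono divide_right_mono ge_one_powr_ge_zero)
    have s0: "summable (\<lambda>n. (real n + 1) powr (b + 1) * ?E n)" by (rule S) (use b x in auto)
    have s1: "summable (\<lambda>n. (real n + 1) powr (a + b + 1) * ?E n)" by (rule S) (use a b x in auto)
    have s2: "summable (\<lambda>n. (real n + 1) powr (2 * a + b + 2) * ?E n)" by (rule S) (use a b x in auto)
    note sK = summable_K_term[OF a x0, of b]
    have sum_rhs: "(\<lambda>n. ((real n + 1) powr (a + b + 1) * ?E n) / x
        + 2 * ((real n + 1) powr (2 * a + b + 2) * ?E n) / x\<^sup>2
        + (real n + 1) powr (b + 1) * exp (- (sqrt (real n + 1) / (2 * (a + 1)))))
      sums (S (a + b + 1) x / x + 2 * S (2 * a + b + 2) x / x\<^sup>2 + T)"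
      unfolding S_def T_def by (intro sums_add sums_divide sums_mult summable_sums s1 s2 T)
    note sm = sums_summable[OF sum_rhs]
    have diff: "K a b x - S (b + 1) x = (\<Sum>n. K_term a b x (Suc n) - (real n + 1) powr (b + 1) * ?E n)"
      unfolding K_def S_def by (rule suminf_diff[OF sK s0])
    have abs: "summable (\<lambda>n. \<bar>K_term a b x (Suc n) - (real n + 1) powr (b + 1) * ?E n\<bar>)"
      by (rule summable_comparison_test'[OF sm]) (use K_term_approx[OF a x0, of b] in simp)
    have "\<bar>K a b x - S (b + 1) x\<bar> \<le> S (a + b + 1) x / x + 2 * S (2 * a + b + 2) x / x\<^sup>2 + T"
      unfolding diff sums_unique[OF sum_rhs]
      by (rule order_trans[OF summable_rabs[OF abs] suminf_le[OF K_term_approx[OF a x0] abs sm]])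
    moreover have "S (a + b + 1) x / x \<le> \<bar>B1\<bar> * ?r"
    proof -
      have "S (a + b + 1) x / x \<le> B1 * x powr ((a + b + 1 + 1) / (a + 1)) / x"
        using B1[OF x] x0 by (intro divide_right_mono) auto
      also have "(a + b + 1 + 1) / (a + 1) = (b + 1) / (a + 1) + 1"
        using a by (simp add: field_simps)
      also have "B1 * x powr ((b + 1) / (a + 1) + 1) / x = B1 * x powr ((b + 1) / (a + 1))"
        using x0 by (simp add: powr_add)
      also have "\<dots> \<le> \<bar>B1\<bar> * ?r" by (intro mult_mono r) auto
      finally show ?thesis .
    qed
    moreover have "S (2 * a + b + 2) x / x\<^sup>2 \<le> \<bar>B2\<bar> * ?r"
    proof -
      have "S (2 * a + b + 2) x / x\<^sup>2 \<le> B2 * x powr ((2 * a + b + 2 + 1) / (a + 1)) / x\<^sup>2"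
        using B2[OF x] x0 by (intro divide_right_mono) auto
      also have "(2 * a + b + 2 + 1) / (a + 1) = (b + 1) / (a + 1) + 2"
        using a by (simp add: field_simps)
      also have "B2 * x powr ((b + 1) / (a + 1) + 2) / x\<^sup>2 = B2 * x powr ((b + 1) / (a + 1))"
        using x0 by (simp add: powr_add)
      also have "\<dots> \<le> \<bar>B2\<bar> * ?r" by (intro mult_mono r) auto
      finally show ?thesis .
    qed
    moreover have "T \<le> \<bar>T\<bar> * ?r"
      using mult_left_mono[OF r(2), of "\<bar>T\<bar>"] by simp
    moreover have "\<bar>S (b + 1) x - moment_const (a + 1) (b + 1) * x powr ((b + 2) / (a + 1))\<bar> \<le> C * ?r"
      using C(2)[OF x] by (simp add: add.assoc)
    ultimately show ?thesis
      unfolding distrib_right mult.assoc times_divide_eq_right[symmetric] by linarith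
  qed
  show ?thesis
    by (rule bigoI[where c = "C + \<bar>B1\<bar> + 2 * \<bar>B2\<bar> + \<bar>T\<bar>"])
       (use main in \<open>auto intro!: eventually_mono[OF eventually_ge_at_top[of 1]]\<close>)
qed

theorem theorem8:
  fixes a b :: real
  assumes "a > 0" and "b > - 2"
  shows "(\<forall>x>0. summable (\<lambda>i. K_term a b x (Suc i))) \<and>
    (b > - 1 \<longrightarrow>
      (\<lambda>x. K a b x
            - Gamma ((b + 2) / (a + 1)) / (a + 1) powr (1 - (b + 2) / (a + 1))
              * x powr ((b + 2) / (a + 1)))
        \<in> O[at_top](\<lambda>x. x powr ((b + 1) / (a + 1)))) \<and>
    (b \<le> - 1 \<longrightarrow>
      (\<lambda>x. K a b x
            - Gamma ((b + 2) / (a + 1)) / (a + 1) powr (1 - (b + 2) / (a + 1))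
              * x powr ((b + 2) / (a + 1)))
        \<in> O[at_top](\<lambda>x. 1))"
proof -
  have const: "Gamma ((b + 2) / (a + 1)) / (a + 1) powr (1 - (b + 2) / (a + 1))
      = moment_const (a + 1) (b + 1)"
  proof -
    have "(a + 1) powr ((b + 2) / (a + 1) - 1) = inverse ((a + 1) powr (1 - (b + 2) / (a + 1)))"
      by (simp add: powr_minus[symmetric])
    then show ?thesis by (simp add: moment_const_def field_simps)
  qed
  have "(\<lambda>x. K a b x - moment_const (a + 1) (b + 1) * x powr ((b + 2) / (a + 1))) \<in> O[at_top](\<lambda>x. 1)"
    if "b \<le> -1"
  proof (rule landau_o.big_trans[OF K_asymptotics[OF assms]])
    have "max 0 (b + 1) = 0" using that by simp
    then show "(\<lambda>x. x powr (max 0 (b + 1) / (a + 1))) \<in> O[at_top](\<lambda>x::real. 1::real)"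
      by (intro bigoI[where c = 1]) auto
  qed
  moreover have "(\<lambda>x. K a b x - moment_const (a + 1) (b + 1) * x powr ((b + 2) / (a + 1)))
      \<in> O[at_top](\<lambda>x. x powr ((b + 1) / (a + 1)))" if "b > -1"
    using K_asymptotics[OF assms] that by simp
  ultimately show ?thesis
    unfolding const by (intro conjI allI impI summable_K_term[OF assms(1)])
qed

end
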